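(* Let $R$ be a finite commutative ring with unity, $1\neq 0$, let $r\in R^\times$ and $a,b\in R$, and let $f(t)=r\left(\frac{1-at}{1-bt}\right)\in R[[t]]$. If $a-b\in R^\times$, then the automaton group $\mathbb{G}(\mathcal{A}_f)=\langle \alpha_{-sra}\,\mu_f\,\alpha_{sb} : s\in R\rangle$ is isomorphic to $R^+\wr\mathbb{Z}$.
   Context: $R^\times$ is the group of units of $R$, $R^+$ its additive group, and $R[[t]]$ the ring of formal power series over $R$; elements of $R$ are viewed as constant power series, and $\frac{1}{1-bt}=\sum_{n\ge 0}b^nt^n$. The set $R^\omega$ of infinite words over the alphabet $R$ is identified with $R[[t]]$ via $(r_0,r_1,r_2,\ldots)\mapsto r_0+r_1t+r_2t^2+\cdots$. For $h\in R[[t]]$ define maps $R[[t]]\to R[[t]]$ by $\mu_h(g)=hg$ and $\alpha_h(g)=h+g$. The map $\alpha_h$ is always a bijection, and $\mu_h$ is a bijection when $h$ is a unit of $R[[t]]$ (equivalently, its constant term is a unit of $R$). Products of maps denote composition (left action). The automaton $\mathcal{A}_f$ is the Mealy automaton with alphabet $R$, state set $Q=\{\alpha_{-sra}\mu_f\alpha_{sb}: s\in R\}$ (a set of permutations of $R[[t]]$), transition function $\delta(\alpha_{-sra}\mu_f\alpha_{sb},\tilde s)=\alpha_{-(sb+\tilde s)ra}\mu_f\alpha_{(sb+\tilde s)b}$ and output function $\lambda(\alpha_{-sra}\mu_f\alpha_{sb},\tilde s)=r(\tilde s+(b-a)s)$ for $s,\tilde s\in R$. The map on $R^\omega=R[[t]]$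 computed by this automaton from the state $q\in Q$ is $q$ itself, and $\mathbb{G}(\mathcal{A}_f)$ is the group of permutations of $R[[t]]$ generated by the elements of $Q$ under composition. $R^+\wr\mathbb{Z}$ denotes the restricted wreath product $\left(\bigoplus_{\mathbb{Z}}R^+\right)\rtimes\mathbb{Z}$, with $\mathbb{Z}$ acting by shifting the coordinates. *)

theory Defs
  imports "HOL-Algebra.Algebra" "HOL-Computational_Algebra.Formal_Power_Series"
begin

section \<open>Mealy automata and the groups they generate\<close>

record ('q, 'a) mealy =
  mealy_states :: "'q set"
  mealy_trans :: "'q \<Rightarrow> 'a \<Rightarrow> 'q"
  mealy_out :: "'q \<Rightarrow> 'a \<Rightarrow> 'a"

text \<open>The state reached from \<open>q\<close> after reading the first \<open>n\<close> letters of the infinite word \<open>w\<close>.\<close>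

primrec mealy_run :: "('q, 'a) mealy \<Rightarrow> 'q \<Rightarrow> (nat \<Rightarrow> 'a) \<Rightarrow> nat \<Rightarrow> 'q" where
  "mealy_run M q w 0 = q"
| "mealy_run M q w (Suc n) = mealy_trans M (mealy_run M q w n) (w n)"

definition mealy_word_map :: "('q, 'a) mealy \<Rightarrow> 'q \<Rightarrow> (nat \<Rightarrow> 'a) \<Rightarrow> nat \<Rightarrow> 'a" where
  "mealy_word_map M q w = (\<lambda>n. mealy_out M (mealy_run M q w n) (w n))"

text \<open>The same map under the identification of infinite words with formal power series.\<close>

definition mealy_map :: "('q, 'a::zero) mealy \<Rightarrow> 'q \<Rightarrow> 'a fps \<Rightarrow> 'a fps" where
  "mealy_map M q g = Abs_fps (mealy_word_map M q (fps_nth g))"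

text \<open>
  Multiplication in \<^term>\<open>BijGroup UNIV\<close> is composition of maps (left action).
  \<^const>\<open>subgroup_generated\<close> ignores generators outside the ambient carrier, so this is the
  automaton group provided that every state computes a permutation.
\<close>

definition automaton_group :: "('q, 'a::zero) mealy \<Rightarrow> ('a fps \<Rightarrow> 'a fps) monoid" where
  "automaton_group M = subgroup_generated (BijGroup UNIV) (mealy_map M ` mealy_states M)"


section \<open>The automaton of \<open>f = r (1 - a t) / (1 - b t)\<close>\<close>

definition add_map :: "'a::comm_ring_1 fps \<Rightarrow> 'a fps \<Rightarrow> 'a fps" where
  "add_map h g = h + g"

definition mult_map :: "'a::comm_ring_1 fps \<Rightarrow> 'a fps \<Rightarrow> 'a fps" where
  "mult_map h g = h * g"

text \<open>
  Division of power series is not available over a general commutative ring, so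
  \<open>1 / (1 - b t)\<close> is written as the geometric series; see \<open>geometric_fps_inverse\<close>.
\<close>

definition geometric_fps :: "'a::comm_ring_1 \<Rightarrow> 'a fps" where
  "geometric_fps b = Abs_fps (\<lambda>n. b ^ n)"

definition f_series :: "'a::comm_ring_1 \<Rightarrow> 'a \<Rightarrow> 'a \<Rightarrow> 'a fps" where
  "f_series r a b = fps_const r * ((1 - fps_const a * fps_X) * geometric_fps b)"

definition f_state :: "'a::comm_ring_1 \<Rightarrow> 'a \<Rightarrow> 'a \<Rightarrow> 'a \<Rightarrow> 'a fps \<Rightarrow> 'a fps" where
  "f_state r a b s =
     add_map (fps_const (- (s * r * a))) \<circ> mult_map (f_series r a b) \<circ> add_map (fps_const (s * b))"

text \<open>
  States are permutations of the power series, and a permutation may be \<^term>\<open>f_state r a b s\<close>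
  for several \<open>s\<close>. The transition and output functions pick one such \<open>s\<close>; the choice is
  irrelevant by \<open>f_automaton_trans\<close> and \<open>f_automaton_out\<close> below.
\<close>

definition f_automaton :: "'a::comm_ring_1 \<Rightarrow> 'a \<Rightarrow> 'a \<Rightarrow> ('a fps \<Rightarrow> 'a fps, 'a) mealy" where
  "f_automaton r a b =
     \<lparr>mealy_states = range (f_state r a b),
      mealy_trans = (\<lambda>q x. let s = (SOME s. q = f_state r a b s) in f_state r a b (s * b + x)),
      mealy_out = (\<lambda>q x. let s = (SOME s. q = f_state r a b s) in r * (x + (b - a) * s))\<rparr>"

lemma geometric_fps_inverse: "(1 - fps_const b * fps_X) * geometric_fps b = 1"
proof (rule fps_ext)
  fix n
  show "fps_nth ((1 - fps_const b * fps_X) * geometric_fps b) n = fps_nth 1 n"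
    by (cases n) (simp_all add: geometric_fps_def algebra_simps mult.assoc)
qed

lemma f_state_apply:
  "f_state r a b s g = f_series r a b * (fps_const (s * b) + g) - fps_const (s * r * a)"
  by (simp add: f_state_def add_map_def mult_map_def flip: fps_const_neg)

lemma f_series_nth_0: "fps_nth (f_series r a b) 0 = r"
  by (simp add: f_series_def geometric_fps_def)

lemma f_state_eqD:
  assumes "f_state r a b s = f_state r a b s'"
  shows "r * (b - a) * s = r * (b - a) * s'"
proof -
  have "fps_nth (f_state r a b s 0) 0 = fps_nth (f_state r a b s' 0) 0"
    using assms by simp
  then show ?thesis
    by (simp add: f_state_apply f_series_nth_0 algebra_simps)
qed

lemma f_state_eqI:
  assumes "r * (b - a) * s = r * (b - a) * s'"
  shows "f_state r a b s = f_state r a b s'"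
proof
  fix g
  define d where "d = s - s'"
  have d: "d * r * a = d * r * b"
    using assms by (simp add: d_def algebra_simps)
  have "fps_const d * f_series r a b
      = (fps_const (d * r) - fps_const (d * r * a) * fps_X) * geometric_fps b"
    by (simp add: f_series_def algebra_simps flip: fps_const_mult)
  also have "\<dots> = fps_const (d * r) * ((1 - fps_const b * fps_X) * geometric_fps b)"
    unfolding d by (simp add: algebra_simps flip: fps_const_mult)
  finally have "fps_const d * f_series r a b = fps_const (d * r)"
    by (simp add: geometric_fps_inverse)
  then have "(fps_const d * f_series r a b) * fps_const b = fps_const (d * r * a)"
    by (simp add: d)
  then have *: "f_series r a b * (fps_const (s * b) - fps_const (s' * b))
      = fps_const (s * r * a) - fps_const (s' * r * a)"
    by (simp add: d_def algebra_simps flip: fps_const_mult fps_const_sub)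
  show "f_state r a b s g = f_state r a b s' g"
    using * by (simp add: f_state_apply algebra_simps del: fps_const_sub)
qed

lemma f_state_some:
  "f_state r a b (SOME s'. f_state r a b s = f_state r a b s') = f_state r a b s"
  by (metis (mono_tags, lifting) someI_ex)

lemma f_automaton_trans:
  "mealy_trans (f_automaton r a b) (f_state r a b s) x = f_state r a b (s * b + x)"
proof -
  define s' where "s' = (SOME s'. f_state r a b s = f_state r a b s')"
  have eq: "r * (b - a) * s' = r * (b - a) * s"
    using f_state_eqD[OF f_state_some] by (simp add: s'_def)
  have "r * (b - a) * (s' * b + x) = (r * (b - a) * s') * b + r * (b - a) * x"
    by (simp add: algebra_simps)
  also have "\<dots> = r * (b - a) * (s * b + x)"
    unfolding eq by (simp add: algebra_simps)
  finally have "f_state r a b (s' * b + x) = f_state r a b (s * b + x)"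
    by (rule f_state_eqI)
  then show ?thesis
    by (simp add: f_automaton_def Let_def s'_def)
qed

lemma f_automaton_out:
  "mealy_out (f_automaton r a b) (f_state r a b s) x = r * (x + (b - a) * s)"
proof -
  define s' where "s' = (SOME s'. f_state r a b s = f_state r a b s')"
  have eq: "r * (b - a) * s' = r * (b - a) * s"
    using f_state_eqD[OF f_state_some] by (simp add: s'_def)
  then show ?thesis
    by (simp add: f_automaton_def Let_def s'_def distrib_left mult.assoc)
qed

lemma f_state_Bij:
  assumes "r dvd 1"
  shows "f_state r a b s \<in> Bij UNIV"
proof -
  obtain u where u: "r * u = 1" using assms by (metis dvdE)
  define h where "h = fps_const u * ((1 - fps_const b * fps_X) * geometric_fps a)"
  have "h * f_series r a b = fps_const (r * u) *
      (((1 - fps_const a * fps_X) * geometric_fps a) * ((1 - fps_const b * fps_X) * geometric_fps b))"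
    unfolding h_def f_series_def fps_const_mult[symmetric] by (simp only: mult_ac)
  then have h: "h * f_series r a b = 1"
    by (simp add: geometric_fps_inverse u)
  then have h': "f_series r a b * h = 1"
    by (simp add: mult.commute)
  have "bij (f_state r a b s)"
  proof (rule o_bij)
    let ?k = "\<lambda>g. h * (g + fps_const (s * r * a)) - fps_const (s * b)"
    show "?k \<circ> f_state r a b s = id"
      by (rule ext) (simp add: f_state_apply h del: fps_const_mult flip: mult.assoc[of h])
    show "f_state r a b s \<circ> ?k = id"
      by (rule ext)
        (simp add: f_state_apply h' del: fps_const_mult flip: mult.assoc[of "f_series r a b"])
  qed
  then show ?thesis
    by (simp add: Bij_def)
qed


section \<open>Restricted wreath products with the integers\<close>

definition semidirect_product ::
    "'n monoid \<Rightarrow> 'h monoid \<Rightarrow> ('h \<Rightarrow> 'n \<Rightarrow> 'n) \<Rightarrow> ('n \<times> 'h) monoid" where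
  "semidirect_product N H \<phi> =
     \<lparr>carrier = carrier N \<times> carrier H,
      monoid.mult = (\<lambda>(x, h) (y, k). (x \<otimes>\<^bsub>N\<^esub> \<phi> h y, h \<otimes>\<^bsub>H\<^esub> k)),
      one = (\<one>\<^bsub>N\<^esub>, \<one>\<^bsub>H\<^esub>)\<rparr>"

definition wreath_int :: "'g monoid \<Rightarrow> ((int \<Rightarrow> 'g) \<times> int) monoid" where
  "wreath_int G =
     semidirect_product (sum_group (UNIV :: int set) (\<lambda>_. G)) integer_group (\<lambda>k x i. x (i - k))"

definition additive_group :: "'a::ab_group_add monoid" where
  "additive_group = \<lparr>carrier = UNIV, monoid.mult = (+), one = 0\<rparr>"

end

theory Submission
  imports Defs "HOL-Computational_Algebra.Polynomial"
begin

text \<open>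
  Write \<open>f = r (1 - a t) / (1 - b t)\<close> and \<open>c = r (b - a) / (1 - b t)\<close>. Since \<open>f b - r a = c\<close>, the
  state with parameter \<open>s\<close> is the affine map \<open>g \<mapsto> f g + c s\<close> (\<open>f_state_affine\<close>), so the generated
  group consists of affine maps with linear part a power of \<open>f\<close>. It contains multiplication by \<open>f\<close>
  and the translations by \<open>c s\<close>; conjugating the latter by the \<open>i\<close>-th power of the former gives the
  translations by \<open>c f\<^sup>i s\<close>. Sending \<open>(x, k)\<close> to \<open>g \<mapsto> c (\<Sum>i. x i f\<^sup>i) + f\<^sup>k g\<close> is thus a surjective
  homomorphism from the wreath product, because the elements \<open>(s \<delta>\<^sub>0, 1)\<close>, whose images are the
  states, generate the wreath product (\<open>wreath_int_generators\<close>).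

  This homomorphism is injective as soon as \<open>c\<close> is a unit and \<open>f\<close> satisfies no nontrivial Laurent
  polynomial equation over \<open>R\<close>: the translation part determines \<open>x\<close>, and \<open>f\<^sup>k = f\<^sup>l\<close> with \<open>k \<noteq> l\<close>
  would itself be such an equation. The first condition holds because the constant term
  \<open>r (b - a)\<close> of \<open>c\<close> is a unit, and it implies the second: \<open>f - r = t c\<close> is a unit multiple of \<open>t\<close>.
  Hence a polynomial in \<open>f\<close> that vanishes can be divided by \<open>f - r\<close> again and again, each remainder
  being the constant term of a series that is \<open>0\<close> (\<open>transcendental_of_linear_term\<close>).

  That the automaton computes its states as maps (\<open>mealy_map_f_state\<close>) follows from
  \<open>f g + c s = r (g + (b - a) F)\<close> with \<open>F = (s + t g) / (1 - b t)\<close>: the coefficients of \<open>F\<close> satisfy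
  the recursion of the transition function, and this formula for the output is the output function.
\<close>

section \<open>States as affine maps\<close>

lemma f_series_cross:
  "(1 - fps_const b * fps_X) * f_series r a b = fps_const r * (1 - fps_const a * fps_X)"
proof -
  have "(1 - fps_const b * fps_X) * f_series r a b
      = fps_const r * (1 - fps_const a * fps_X) * ((1 - fps_const b * fps_X) * geometric_fps b)"
    unfolding f_series_def by (simp only: mult_ac)
  then show ?thesis by (simp add: geometric_fps_inverse)
qed

lemma cancel_geometric:
  fixes b :: "'a::comm_ring_1"
  assumes "(1 - fps_const b * fps_X) * g = (1 - fps_const b * fps_X) * h"
  shows "g = h"
proof -
  have "geometric_fps b * ((1 - fps_const b * fps_X) * g)
      = geometric_fps b * ((1 - fps_const b * fps_X) * h)"
    using assms by simp
  then show ?thesis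
    using geometric_fps_inverse[of b]
    by (simp add: mult.commute[of "geometric_fps b" "1 - _"] flip: mult.assoc)
qed

lemma f_series_eq_linear_term:
  "f_series r a b = fps_const r + fps_X * (fps_const (r * (b - a)) * geometric_fps b)"
proof (rule cancel_geometric[where b = b])
  have "(1 - fps_const b * fps_X) *
      (fps_const r + fps_X * (fps_const (r * (b - a)) * geometric_fps b))
    = (1 - fps_const b * fps_X) * fps_const r
      + fps_X * fps_const (r * (b - a)) * ((1 - fps_const b * fps_X) * geometric_fps b)"
    by (simp only: algebra_simps)
  also have "\<dots> = fps_const r * (1 - fps_const a * fps_X)"
    unfolding geometric_fps_inverse
    by (simp add: algebra_simps flip: fps_const_mult fps_const_sub)
  finally show "(1 - fps_const b * fps_X) * f_series r a b = (1 - fps_const b * fps_X) *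
      (fps_const r + fps_X * (fps_const (r * (b - a)) * geometric_fps b))"
    by (simp only: f_series_cross)
qed

lemma f_state_affine:
  "f_state r a b s g =
     f_series r a b * g + fps_const (r * (b - a)) * geometric_fps b * fps_const s"
proof (rule cancel_geometric[where b = b])
  have "(1 - fps_const b * fps_X) * f_state r a b s g
      = ((1 - fps_const b * fps_X) * f_series r a b) * (fps_const (s * b) + g)
        - (1 - fps_const b * fps_X) * fps_const (s * r * a)"
    by (simp only: f_state_apply right_diff_distrib mult.assoc)
  also have "\<dots> = fps_const r * (1 - fps_const a * fps_X) * g + fps_const (r * (b - a)) * fps_const s"
    unfolding f_series_cross
    by (simp add: algebra_simps flip: fps_const_mult fps_const_sub)
  also have "\<dots> = ((1 - fps_const b * fps_X) * f_series r a b) * g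
      + fps_const (r * (b - a)) * ((1 - fps_const b * fps_X) * geometric_fps b) * fps_const s"
    unfolding f_series_cross geometric_fps_inverse by simp
  finally show "(1 - fps_const b * fps_X) * f_state r a b s g = (1 - fps_const b * fps_X) *
      (f_series r a b * g + fps_const (r * (b - a)) * geometric_fps b * fps_const s)"
    by (simp only: algebra_simps)
qed

text \<open>
  The series \<open>F\<close> below records the parameters of the states visited while reading \<open>g\<close>.
\<close>

lemma mealy_map_f_state: "mealy_map (f_automaton r a b) (f_state r a b s) = f_state r a b s"
proof
  fix g
  define F where "F = (fps_const s + fps_X * g) * geometric_fps b"
  have geo: "(1 - fps_const b * fps_X) * F = fps_const s + fps_X * g"
    unfolding F_def using geometric_fps_inverse[of b]
    by (metis mult.left_commute mult.right_neutral)
  have "F = (1 - fps_const b * fps_X) * F + fps_const b * fps_X * F"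
    by (simp add: algebra_simps)
  also have "(1 - fps_const b * fps_X) * F = fps_const s + fps_X * g"
    by (rule geo)
  finally have F: "F = fps_const s + fps_X * (g + fps_const b * F)"
    by (simp add: algebra_simps)
  have F_0: "fps_nth F 0 = s"
    by (subst F) simp
  have F_Suc: "fps_nth F (Suc n) = fps_nth F n * b + fps_nth g n" for n
    by (subst F) (simp add: mult.commute)
  have run: "mealy_run (f_automaton r a b) (f_state r a b s) (fps_nth g) n
      = f_state r a b (fps_nth F n)" for n
    by (induction n) (simp_all add: F_0 F_Suc f_automaton_trans)
  have out: "f_state r a b s g = fps_const r * (g + fps_const (b - a) * F)"
    unfolding f_state_affine f_series_eq_linear_term F_def fps_const_mult[symmetric]
    by (simp only: distrib_left distrib_right mult_ac add_ac)
  show "mealy_map (f_automaton r a b) (f_state r a b s) g = f_state r a b s g"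
    by (rule fps_ext) (simp add: mealy_map_def mealy_word_map_def run f_automaton_out out)
qed


section \<open>Transcendence over the coefficient ring\<close>

text \<open>
  Division of \<open>P\<close> by \<open>Z - r\<close>, evaluated at a power series: quotient and remainder still have
  coefficients in the ring of constants, which is what allows the division to be iterated below.
\<close>

lemma poly_map_poly_synthetic_div:
  fixes u :: "'a::comm_ring_1 fps"
  shows "poly (map_poly fps_const P) u = fps_const (poly P r)
    + (u - fps_const r) * poly (map_poly fps_const (synthetic_div P r)) u"
proof (induction P)
  case (pCons x P)
  show ?case
    by (simp add: map_poly_pCons pCons.IH)
      (simp add: algebra_simps flip: fps_const_mult fps_const_add)
qed simp

text \<open>
  If \<open>P (r + t w) = 0\<close>, then comparing constant terms gives \<open>P r = 0\<close>, so \<open>P = (Z - r) S\<close> for the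
  quotient \<open>S\<close> of synthetic division, and \<open>t w S (r + t w) = 0\<close>. Since \<open>t\<close> is not a zero divisor and
  \<open>w\<close> is a unit, \<open>S\<close> vanishes at \<open>r + t w\<close> as well. As \<open>S\<close> is \<open>0\<close> or of smaller degree
  than \<open>P\<close>, induction gives \<open>S = 0\<close>, hence \<open>P = 0\<close>.
\<close>

lemma transcendental_of_linear_term:
  fixes w :: "'a::comm_ring_1 fps"
  assumes "w dvd 1"
    and "poly (map_poly fps_const P) (fps_const r + fps_X * w) = 0"
  shows "P = 0"
  using assms(2)
proof (induction "degree P" arbitrary: P rule: less_induct)
  case less
  define S where "S = synthetic_div P r"
  define E where "E Q = poly (map_poly fps_const Q) (fps_const r + fps_X * w)" for Q
  have eq: "fps_const (poly P r) + fps_X * (w * E S) = 0"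
    using poly_map_poly_synthetic_div[of P "fps_const r + fps_X * w" r] less.prems
    by (simp add: E_def S_def mult.assoc)
  have "fps_nth (fps_const (poly P r) + fps_X * (w * E S)) 0 = 0"
    unfolding eq by simp
  then have root: "poly P r = 0" by simp
  obtain w' where w': "1 = w * w'" using assms(1) by (elim dvdE)
  have "w * E S = 0"
  proof (rule fps_ext)
    fix n
    have "fps_nth (fps_X * (w * E S)) (Suc n) = 0"
      using eq root by simp
    then show "fps_nth (w * E S) n = fps_nth 0 n" by simp
  qed
  then have "w * w' * E S = 0" by (simp add: mult.assoc mult.left_commute[of w])
  then have ES: "E S = 0" by (simp flip: w')
  have "S = 0"
  proof (cases "degree P = 0")
    case True
    then show ?thesis by (simp add: S_def synthetic_div_eq_0_iff)
  next
    case False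
    then have "degree S < degree P" by (simp add: S_def degree_synthetic_div)
    then show ?thesis using ES less.hyps unfolding E_def by blast
  qed
  then show "P = 0"
    using synthetic_div_correct[of P r] root by (simp add: S_def)
qed

lemma dvd_one_mult:
  fixes x y :: "'a::comm_ring_1"
  assumes "x dvd 1" "y dvd 1"
  shows "x * y dvd 1"
  using mult_dvd_mono[OF assms] by simp

lemma fps_const_dvd_one:
  fixes x :: "'a::comm_ring_1"
  assumes "x dvd 1"
  shows "fps_const x dvd 1"
proof -
  obtain y where "1 = x * y" using assms by (elim dvdE)
  then have "1 = fps_const x * fps_const y" by simp
  then show ?thesis by (rule dvdI)
qed

lemma geometric_fps_dvd_one: "geometric_fps b dvd 1"
  by (metis geometric_fps_inverse dvd_triv_right)


section \<open>The wreath product of an additive group with the integers\<close>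

lemma group_additive_group: "group (additive_group :: 'a::ab_group_add monoid)"
  by (rule groupI) (auto simp: additive_group_def add.assoc intro: exI[where x = "- _"])

lemma carrier_wreath_int [simp]:
  "carrier (wreath_int (additive_group :: 'a::ab_group_add monoid))
     = {x. finite {i. x i \<noteq> 0}} \<times> UNIV"
  by (simp add: wreath_int_def semidirect_product_def carrier_sum_group group_additive_group)
    (simp add: additive_group_def)

lemma mult_wreath_int [simp]:
  "(x, k) \<otimes>\<^bsub>wreath_int additive_group\<^esub> (y, l) = (\<lambda>i. x i + y (i - k), k + l)"
  by (simp add: wreath_int_def semidirect_product_def additive_group_def restrict_def)

lemma one_wreath_int [simp]: "\<one>\<^bsub>wreath_int additive_group\<^esub> = (\<lambda>_. 0, 0)"
  by (simp add: wreath_int_def semidirect_product_def restrict_def) (simp add: additive_group_def)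

lemma finite_support_shift:
  fixes x :: "int \<Rightarrow> 'a::zero"
  assumes "finite {i. x i \<noteq> 0}"
  shows "finite {i. x (i - k) \<noteq> 0}"
proof -
  have "{i. x (i - k) \<noteq> 0} = (\<lambda>i. i + k) ` {i. x i \<noteq> 0}"
    by (force simp: image_iff intro: exI[where x = "_ - k"])
  then show ?thesis using assms by simp
qed

lemma finite_support_add:
  fixes x y :: "'i \<Rightarrow> 'a::monoid_add"
  assumes "finite {i. x i \<noteq> 0}" "finite {i. y i \<noteq> 0}"
  shows "finite {i. x i + y i \<noteq> 0}"
  by (rule finite_subset[OF _ finite_UnI[OF assms]]) auto

lemma group_wreath_int: "group (wreath_int (additive_group :: 'a::ab_group_add monoid))"
proof (rule groupI)
  fix p assume "p \<in> carrier (wreath_int (additive_group :: 'a monoid))"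
  then obtain x k where p: "p = (x, k)" and x: "finite {i. x i \<noteq> 0}" by auto
  have "(\<lambda>i. - x (i - (- k)), - k) \<otimes>\<^bsub>wreath_int additive_group\<^esub> p
      = \<one>\<^bsub>wreath_int additive_group\<^esub>"
    by (simp add: p)
  moreover have "(\<lambda>i. - x (i - (- k)), - k) \<in> carrier (wreath_int (additive_group :: 'a monoid))"
    using finite_support_shift[OF x, of "- k"] by simp
  ultimately show "\<exists>q\<in>carrier (wreath_int (additive_group :: 'a monoid)).
      q \<otimes>\<^bsub>wreath_int additive_group\<^esub> p = \<one>\<^bsub>wreath_int additive_group\<^esub>"
    by blast
qed (auto simp: add.assoc diff_diff_eq finite_support_add finite_support_shift)

abbreviation single :: "int \<Rightarrow> 'a::zero \<Rightarrow> int \<Rightarrow> 'a" where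
  "single i s \<equiv> (\<lambda>_. 0)(i := s)"

text \<open>
  The shifts \<open>(0, k)\<close> are the powers of the generator for \<open>s = 0\<close>. Cancelling
  the shift in a generator leaves \<open>(s \<delta>\<^sub>0, 0)\<close>, its conjugates by shifts are all \<open>(s \<delta>\<^sub>i, 0)\<close>, and
  these span the base group.
\<close>

lemma wreath_int_generators:
  "generate (wreath_int additive_group) {(single 0 s, 1) | s. True}
     = carrier (wreath_int (additive_group :: 'a::ab_group_add monoid))"
    (is "generate ?W ?S = _")
proof
  interpret W: group ?W by (rule group_wreath_int)
  have S: "?S \<subseteq> carrier ?W" by auto
  show "generate ?W ?S \<subseteq> carrier ?W"
    by (rule W.generate_incl[OF S])
  have sub: "subgroup (generate ?W ?S) ?W"
    by (rule W.generate_is_subgroup[OF S])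
  note mult = subgroup.m_closed[OF sub]
  have gen: "(single 0 s, 1) \<in> generate ?W ?S" for s
    by (rule generate.incl) blast
  have pos: "(\<lambda>_. 0, int n) \<in> generate ?W ?S" for n
  proof (induction n)
    case 0
    show ?case using generate.one[of ?W ?S] by (simp only: one_wreath_int of_nat_0)
  next
    case (Suc n)
    have "(single 0 0, 1) \<otimes>\<^bsub>?W\<^esub> (\<lambda>_. 0, int n) = (\<lambda>_. 0, int (Suc n))"
      by (auto simp: fun_upd_idem)
    then show ?case using mult[OF gen[of 0] Suc] by (simp only:)
  qed
  have neg: "(\<lambda>_. 0, - int n) \<in> generate ?W ?S" for n
  proof -
    have "inv\<^bsub>?W\<^esub> (\<lambda>_. 0, int n) = (\<lambda>_. 0, - int n)"
      by (rule W.inv_equality) auto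
    then show ?thesis using subgroup.m_inv_closed[OF sub pos[of n]] by simp
  qed
  have shift: "(\<lambda>_. 0, k) \<in> generate ?W ?S" for k
    by (cases k rule: int_cases2) (simp_all only: pos neg)
  have single: "(single i s, 0) \<in> generate ?W ?S" for i s
  proof -
    \<comment> \<open>Conjugation by \<open>(0, i)\<close>; the extra \<open>- 1\<close> cancels the shift of the generator.\<close>
    have "(\<lambda>_. 0, i) \<otimes>\<^bsub>?W\<^esub> ((single 0 s, 1) \<otimes>\<^bsub>?W\<^esub> (\<lambda>_. 0, - 1 - i)) = (single i s, 0)"
      by auto
    then show ?thesis using mult[OF shift[of i] mult[OF gen[of s] shift[of "- 1 - i"]]]
      by (simp only:)
  qed
  have base: "(x, 0) \<in> generate ?W ?S" if "finite A" "{i. x i \<noteq> 0} \<subseteq> A" for A x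
    using that
  proof (induction A arbitrary: x rule: finite_induct)
    case empty
    then have x: "x = (\<lambda>_. 0)" by auto
    show ?case unfolding x by (rule shift)
  next
    case (insert i A)
    have "(x(i := 0), 0) \<in> generate ?W ?S"
      using insert.prems by (intro insert.IH) auto
    moreover have "(single i (x i), 0) \<otimes>\<^bsub>?W\<^esub> (x(i := 0), 0) = (x, 0)"
      by auto
    ultimately show ?case using mult[OF single[of i "x i"], of "(x(i := 0), 0)"] by (simp only:)
  qed
  show "carrier ?W \<subseteq> generate ?W ?S"
  proof
    fix p assume "p \<in> carrier ?W"
    then obtain x k where p: "p = (x, k)" and x: "finite {i. x i \<noteq> 0}" by auto
    have "(x, 0) \<otimes>\<^bsub>?W\<^esub> (\<lambda>_. 0, k) \<in> generate ?W ?S"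
      by (rule mult[OF base[OF x order_refl] shift])
    then show "p \<in> generate ?W ?S" by (simp add: p)
  qed
qed


section \<open>Laurent polynomials in a transcendental unit\<close>

locale transcendental_unit =
  fixes u v :: "'a::comm_ring_1 fps"
  assumes unit: "u * v = 1"
    and transcendental: "poly (map_poly fps_const P) u = 0 \<Longrightarrow> P = 0"
begin

text \<open>
  Integer powers of \<open>u\<close>. At most one of the two exponents is nonzero.
\<close>

definition upow :: "int \<Rightarrow> 'a fps" where
  "upow k = u ^ nat k * v ^ nat (- k)"

lemma power_mult_power: "u ^ m * v ^ n = upow (int m - int n)"
proof (cases "n \<le> m")
  case True
  then have "u ^ m = u ^ (m - n) * u ^ n" by (simp flip: power_add)
  then have "u ^ m * v ^ n = u ^ (m - n) * (u * v) ^ n" by (simp add: power_mult_distrib mult_ac)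
  then show ?thesis using True by (simp add: unit upow_def nat_diff_distrib)
next
  case False
  then have "v ^ n = v ^ m * v ^ (n - m)" by (simp flip: power_add)
  then have "u ^ m * v ^ n = (u * v) ^ m * v ^ (n - m)" by (simp add: power_mult_distrib mult_ac)
  then show ?thesis using False by (simp add: unit upow_def nat_diff_distrib)
qed

lemma upow_0 [simp]: "upow 0 = 1" and upow_1 [simp]: "upow 1 = u"
  by (simp_all add: upow_def)

lemma upow_of_nat: "upow (int n) = u ^ n"
  by (simp add: upow_def)

lemma upow_add: "upow (k + l) = upow k * upow l"
proof -
  have "upow k * upow l = u ^ (nat k + nat l) * v ^ (nat (- k) + nat (- l))"
    by (simp add: upow_def power_add mult_ac)
  also have "\<dots> = upow (k + l)"
    unfolding power_mult_power by (rule arg_cong[where f = upow]) auto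
  finally show ?thesis ..
qed

definition laurent :: "(int \<Rightarrow> 'a) \<Rightarrow> 'a fps" where
  "laurent x = (\<Sum>i | x i \<noteq> 0. fps_const (x i) * upow i)"

lemma laurent_superset:
  assumes "finite A" "{i. x i \<noteq> 0} \<subseteq> A"
  shows "laurent x = (\<Sum>i\<in>A. fps_const (x i) * upow i)"
  unfolding laurent_def by (rule sum.mono_neutral_left[OF assms]) auto

lemma laurent_single [simp]: "laurent (single i s) = fps_const s * upow i"
  by (subst laurent_superset[where A = "{i}"]) auto

lemma laurent_add:
  assumes "finite {i. x i \<noteq> 0}" "finite {i. y i \<noteq> 0}"
  shows "laurent (\<lambda>i. x i + y i) = laurent x + laurent y"
proof -
  define A where "A = {i. x i \<noteq> 0} \<union> {i. y i \<noteq> 0}"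
  have fin: "finite A" using assms by (simp add: A_def)
  have "laurent x = (\<Sum>i\<in>A. fps_const (x i) * upow i)"
       "laurent y = (\<Sum>i\<in>A. fps_const (y i) * upow i)"
       "laurent (\<lambda>i. x i + y i) = (\<Sum>i\<in>A. fps_const (x i + y i) * upow i)"
    by (rule laurent_superset[OF fin]; auto simp: A_def)+
  then show ?thesis
    by (simp add: sum.distrib distrib_right flip: fps_const_add)
qed

lemma laurent_minus: "laurent (\<lambda>i. - x i) = - laurent x"
  by (simp add: laurent_def sum_negf flip: fps_const_neg)

lemma laurent_shift: "laurent (\<lambda>i. x (i - k)) = upow k * laurent x"
proof -
  have "laurent (\<lambda>i. x (i - k)) = (\<Sum>i | x i \<noteq> 0. fps_const (x i) * upow (i + k))"
    unfolding laurent_def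
    by (rule sum.reindex_bij_witness[where i = "\<lambda>i. i + k" and j = "\<lambda>i. i - k"]) auto
  then show ?thesis
    by (simp add: laurent_def upow_add sum_distrib_left mult_ac)
qed

text \<open>
  Multiplication by a high power of \<open>u\<close> clears the negative exponents; what remains is a polynomial
  in \<open>u\<close>, to which transcendence applies.
\<close>

lemma laurent_eq_0:
  assumes "finite {i. x i \<noteq> 0}" and "laurent x = 0"
  shows "x i = 0"
proof -
  obtain N where N: "\<And>j. x j \<noteq> 0 \<Longrightarrow> \<bar>j\<bar> \<le> int N"
  proof -
    have "finite ((\<lambda>j. nat \<bar>j\<bar>) ` {j. x j \<noteq> 0})" using assms(1) by simp
    then obtain N where "\<forall>n\<in>(\<lambda>j. nat \<bar>j\<bar>) ` {j. x j \<noteq> 0}. n \<le> N"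
      using finite_nat_set_iff_bounded_le by blast
    then show ?thesis by (intro that[of N]) auto
  qed
  define P where "P = (\<Sum>n\<le>2 * N. monom (x (int n - int N)) n)"
  have coeff_P: "coeff P n = (if n \<le> 2 * N then x (int n - int N) else 0)" for n
    by (simp add: P_def coeff_sum)
  have "map_poly fps_const P = (\<Sum>n\<le>2 * N. monom (fps_const (x (int n - int N))) n)"
    by (rule poly_eqI) (simp add: coeff_map_poly coeff_P coeff_sum)
  then have "poly (map_poly fps_const P) u = (\<Sum>n\<le>2 * N. fps_const (x (int n - int N)) * u ^ n)"
    by (simp add: poly_sum poly_monom)
  also have "\<dots> = (\<Sum>i\<in>int ` {..2 * N}. fps_const (x (i - int N)) * upow i)"
    by (subst sum.reindex) (simp_all add: upow_of_nat)
  also have "\<dots> = laurent (\<lambda>i. x (i - int N))"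
  proof (rule laurent_superset[symmetric])
    show "{i. x (i - int N) \<noteq> 0} \<subseteq> int ` {..2 * N}"
    proof
      fix i assume "i \<in> {i. x (i - int N) \<noteq> 0}"
      then have "\<bar>i - int N\<bar> \<le> int N" using N by auto
      then show "i \<in> int ` {..2 * N}" by (intro image_eqI[where x = "nat i"]) auto
    qed
  qed simp
  also have "\<dots> = 0" by (simp add: laurent_shift assms(2))
  finally have "P = 0" by (rule transcendental)
  show "x i = 0"
  proof (rule ccontr)
    assume "x i \<noteq> 0"
    then have "\<bar>i\<bar> \<le> int N" by (rule N)
    then have "coeff P (nat (i + int N)) = x i" by (auto simp: coeff_P)
    then show False using \<open>P = 0\<close> \<open>x i \<noteq> 0\<close> by simp
  qed
qed

lemma laurent_inject:
  assumes x: "finite {i. x i \<noteq> 0}" and y: "finite {i. y i \<noteq> 0}" and eq: "laurent x = laurent y"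
  shows "x = y"
proof
  fix i
  have y': "finite {i. - y i \<noteq> 0}" using y by simp
  have "laurent (\<lambda>i. x i + - y i) = 0"
    unfolding laurent_add[OF x y'] laurent_minus by (simp add: eq)
  then have "x i + - y i = 0"
    by (rule laurent_eq_0[OF finite_support_add[OF x y']])
  then show "x i = y i" by simp
qed

text \<open>
  An equality \<open>u\<^sup>k = u\<^sup>l\<close> equates two one-term Laurent polynomials with coefficient \<open>1 \<noteq> 0\<close>.
\<close>

lemma upow_inject:
  assumes "upow k = upow l"
  shows "k = l"
proof -
  have "single k (1 :: 'a) = single l 1"
    by (rule laurent_inject) (simp_all add: assms)
  then have "single k (1 :: 'a) k = single l 1 k" by simp
  then show ?thesis by (simp split: if_splits)
qed

text \<open>
  The base group acts by the translations by \<open>c\<close> times a Laurent polynomial in \<open>u\<close>, the shift as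
  multiplication by \<open>u\<close>. The two fit together since shifting a coefficient family multiplies
  its Laurent polynomial by \<open>u\<close>.
\<close>

fun wreath_action :: "'a fps \<Rightarrow> (int \<Rightarrow> 'a) \<times> int \<Rightarrow> 'a fps \<Rightarrow> 'a fps" where
  "wreath_action c (x, k) g = c * laurent x + upow k * g"

lemma wreath_action_Bij: "wreath_action c p \<in> Bij UNIV"
proof -
  obtain x k where p: "p = (x, k)" by fastforce
  have inv: "upow k * upow (- k) = 1" "upow (- k) * upow k = 1"
    using upow_add[of k "- k"] upow_add[of "- k" k] by simp_all
  have "bij (wreath_action c p)"
  proof (rule o_bij)
    let ?h = "\<lambda>g. upow (- k) * (g - c * laurent x)"
    show "?h \<circ> wreath_action c p = id"
      by (rule ext) (simp add: p inv flip: mult.assoc)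
    show "wreath_action c p \<circ> ?h = id"
      by (rule ext) (simp add: p inv flip: mult.assoc)
  qed
  then show ?thesis by (simp add: Bij_def)
qed

lemma wreath_action_hom:
  "wreath_action c \<in> hom (wreath_int additive_group) (BijGroup UNIV)"
proof (rule homI)
  fix p q
  assume "p \<in> carrier (wreath_int (additive_group :: 'a monoid))"
    and "q \<in> carrier (wreath_int (additive_group :: 'a monoid))"
  then obtain x k y l where p: "p = (x, k)" and q: "q = (y, l)"
    and x: "finite {i. x i \<noteq> 0}" and y: "finite {i. y i \<noteq> 0}"
    by auto
  have "wreath_action c (p \<otimes>\<^bsub>wreath_int additive_group\<^esub> q) g
      = wreath_action c p (wreath_action c q g)" for g
    unfolding p q mult_wreath_int wreath_action.simps
      laurent_add[OF x finite_support_shift[OF y]] laurent_shift upow_add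
    by (simp add: algebra_simps)
  then show "wreath_action c (p \<otimes>\<^bsub>wreath_int additive_group\<^esub> q)
      = wreath_action c p \<otimes>\<^bsub>BijGroup UNIV\<^esub> wreath_action c q"
    by (simp add: BijGroup_def wreath_action_Bij fun_eq_iff compose_def)
qed (simp add: BijGroup_def wreath_action_Bij)

text \<open>
  The value at \<open>0\<close> determines the translation part, then the value at \<open>1\<close> the linear part.
\<close>

lemma wreath_action_inj:
  assumes "c dvd 1"
  shows "inj_on (wreath_action c) (carrier (wreath_int additive_group))"
proof (rule inj_onI)
  fix p q
  assume "p \<in> carrier (wreath_int (additive_group :: 'a monoid))"
    and "q \<in> carrier (wreath_int (additive_group :: 'a monoid))"
    and eq: "wreath_action c p = wreath_action c q"
  then obtain x k y l where p: "p = (x, k)" and q: "q = (y, l)"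
    and x: "finite {i. x i \<noteq> 0}" and y: "finite {i. y i \<noteq> 0}"
    by auto
  obtain d where d: "1 = d * c"
    using assms by (metis dvdE mult.commute)
  have c: "c * laurent x = c * laurent y"
    using fun_cong[OF eq, of 0] by (simp add: p q)
  then have "d * c * laurent x = d * c * laurent y" by (simp add: mult.assoc)
  then have "x = y" by (intro laurent_inject[OF x y]) (simp flip: d)
  moreover have "k = l"
    using fun_cong[OF eq, of 1] c by (intro upow_inject) (simp add: p q)
  ultimately show "p = q" by (simp add: p q)
qed

text \<open>
  The given affine maps are the images of the generators in \<open>wreath_int_generators\<close>, so the group
  that they generate is the whole image of the wreath product.
\<close>

lemma generated_iso_wreath:
  assumes "c dvd 1"
  shows "subgroup_generated (BijGroup UNIV) {\<lambda>g. u * g + c * fps_const s | s. True}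
    \<cong> wreath_int (additive_group :: 'a monoid)"
proof -
  let ?W = "wreath_int (additive_group :: 'a monoid)"
  let ?S = "{(single 0 s, 1) | s :: 'a. True}"
  let ?T = "{\<lambda>g. u * g + c * fps_const s | s. True}"
  interpret group_hom ?W "BijGroup UNIV" "wreath_action c"
    by (intro group_hom.intro group_hom_axioms.intro group_wreath_int group_BijGroup wreath_action_hom)
  have gen: "wreath_action c (single 0 s, 1) = (\<lambda>g. u * g + c * fps_const s)" for s
    by (rule ext) (simp add: algebra_simps)
  have T: "?T = wreath_action c ` ?S"
    by (force simp flip: gen simp del: wreath_action.simps)
  have "?T \<subseteq> carrier (BijGroup UNIV)"
    unfolding T by (auto simp: BijGroup_def wreath_action_Bij simp del: wreath_action.simps)
  then have "carrier (subgroup_generated (BijGroup UNIV) ?T) = generate (BijGroup UNIV) ?T"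
    by (simp add: carrier_subgroup_generated Int_absorb1)
  also have "\<dots> = wreath_action c ` generate ?W ?S"
    unfolding T by (rule generate_img) auto
  finally have img: "carrier (subgroup_generated (BijGroup UNIV) ?T)
      = wreath_action c ` carrier ?W"
    unfolding wreath_int_generators .
  have "wreath_action c \<in> hom ?W (subgroup_generated (BijGroup UNIV) ?T)"
  proof (rule homI)
    show "wreath_action c p \<in> carrier (subgroup_generated (BijGroup UNIV) ?T)"
      if "p \<in> carrier ?W" for p
      unfolding img using that by (rule imageI)
  qed (simp add: hom_mult del: carrier_wreath_int)
  then have "wreath_action c \<in> iso ?W (subgroup_generated (BijGroup UNIV) ?T)"
    by (rule isoI) (simp only: bij_betw_def img wreath_action_inj[OF assms])
  then have "?W \<cong> subgroup_generated (BijGroup UNIV) ?T"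
    by (rule is_isoI)
  then show ?thesis
    by (rule group.iso_sym[OF group_wreath_int])
qed

end


section \<open>The automaton group\<close>

theorem theorem3p6:
  fixes r a b :: "'a::{finite, comm_ring_1}"
  assumes "r dvd 1"
    and "a - b dvd 1"
  shows "automaton_group (f_automaton r a b) =
      subgroup_generated (BijGroup UNIV)
        {add_map (fps_const (- (s * r * a))) \<circ> mult_map (f_series r a b) \<circ> add_map (fps_const (s * b))
          | s. s \<in> UNIV}
    \<and> automaton_group (f_automaton r a b) \<cong> wreath_int (additive_group :: 'a monoid)"
proof
  have states: "mealy_map (f_automaton r a b) ` mealy_states (f_automaton r a b)
      = range (f_state r a b)"
    by (simp add: f_automaton_def[of r a b, THEN arg_cong[where f = mealy_states]]
        image_image mealy_map_f_state)
  then show "automaton_group (f_automaton r a b) = subgroup_generated (BijGroup UNIV)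
      {add_map (fps_const (- (s * r * a))) \<circ> mult_map (f_series r a b) \<circ> add_map (fps_const (s * b))
        | s. s \<in> UNIV}"
    unfolding automaton_group_def by (simp add: f_state_def full_SetCompr_eq)
  define c where "c = fps_const (r * (b - a)) * geometric_fps b"
  have "b - a dvd 1"
    using assms(2) by (metis minus_diff_eq minus_dvd_iff)
  then have c: "c dvd 1"
    unfolding c_def using assms(1)
    by (intro dvd_one_mult fps_const_dvd_one geometric_fps_dvd_one)
  have "f_series r a b dvd 1"
  proof -
    have "(1 - fps_const a * fps_X) dvd 1"
      by (metis geometric_fps_inverse dvd_triv_left)
    then show ?thesis
      unfolding f_series_def using assms(1)
      by (intro dvd_one_mult fps_const_dvd_one geometric_fps_dvd_one)
  qed
  then obtain v where v: "f_series r a b * v = 1"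
    by (metis dvdE)
  interpret transcendental_unit "f_series r a b" v
  proof
    fix P assume "poly (map_poly fps_const P) (f_series r a b) = 0"
    then show "P = 0"
      using transcendental_of_linear_term[OF c, of P r]
      unfolding f_series_eq_linear_term c_def by blast
  qed (rule v)
  have "f_state r a b s = (\<lambda>g. f_series r a b * g + c * fps_const s)" for s
    by (rule ext) (simp only: f_state_affine c_def)
  then have "range (f_state r a b) = {\<lambda>g. f_series r a b * g + c * fps_const s | s. True}"
    by auto
  then show "automaton_group (f_automaton r a b) \<cong> wreath_int (additive_group :: 'a monoid)"
    unfolding automaton_group_def states using generated_iso_wreath[OF c] by simp
qed

end
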